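(* Let $\eta,\ell\in\mathbb{R}$ with $\ell>-3/2$, $\ell\neq-1$ and $\eta\neq0$. Then the following hold. (i) If $H>0$, the zeros of $x\phi_{\ell,\eta}(x)$ and the zeros of $x\phi_{\ell,\eta}'(x)+H\phi_{\ell,\eta}(x)$ are interlaced. (ii) The zeros of $\phi_{\ell,\eta}(x)$ and the zeros of $\phi_{\ell,\eta}'(x)$ are interlaced.
   Context: For real $\eta$ and $\ell>-3/2$, $\ell\neq-1$, $$\phi_{\ell,\eta}(x)=e^{-ix}\,{}_1F_1(\ell+1-i\eta,\,2\ell+2;\,2ix),\qquad {}_1F_1(a,b;z)=\sum_{k\ge0}\frac{(a)_k}{(b)_k}\frac{z^k}{k!},$$ where $(a)_k=\Gamma(a+k)/\Gamma(a)$; this is an entire function of $x$ that is real-valued on $\mathbb{R}$. The zeros (on the real line) of two functions are interlaced if the functions have no common zero and between any two consecutive zeros of either one there is exactly one zero of the other. *)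

theory Defs
  imports "HOL-Analysis.Analysis"
begin

definition kummer_1F1 :: "complex \<Rightarrow> complex \<Rightarrow> complex \<Rightarrow> complex" where
  "kummer_1F1 a b z = (\<Sum>k. pochhammer a k / pochhammer b k * (z ^ k / fact k))"

(* For l > -3/2, l ~= -1 the lower parameter 2 l + 2 is not a non-positive integer,
   so no denominator of the series vanishes. *)
definition coulomb_phi :: "real \<Rightarrow> real \<Rightarrow> complex \<Rightarrow> complex" where
  "coulomb_phi l \<eta> x =
     exp (- \<i> * x) *
     kummer_1F1 (of_real (l + 1) - \<i> * of_real \<eta>) (of_real (2 * l + 2)) (2 * \<i> * x)"

definition consecutive_real_zeros :: "(complex \<Rightarrow> complex) \<Rightarrow> real \<Rightarrow> real \<Rightarrow> bool" where
  "consecutive_real_zeros f a b \<longleftrightarrow>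
     a < b \<and> f (of_real a) = 0 \<and> f (of_real b) = 0 \<and>
     (\<forall>t. a < t \<and> t < b \<longrightarrow> f (of_real t) \<noteq> 0)"

(* Zeros are those on the real line, taken as points (without multiplicity). *)
definition real_zeros_interlaced :: "(complex \<Rightarrow> complex) \<Rightarrow> (complex \<Rightarrow> complex) \<Rightarrow> bool" where
  "real_zeros_interlaced f g \<longleftrightarrow>
     (\<nexists>t::real. f (of_real t) = 0 \<and> g (of_real t) = 0) \<and>
     (\<forall>a b. consecutive_real_zeros f a b \<longrightarrow> (\<exists>!t::real. a < t \<and> t < b \<and> g (of_real t) = 0)) \<and>
     (\<forall>a b. consecutive_real_zeros g a b \<longrightarrow> (\<exists>!t::real. a < t \<and> t < b \<and> f (of_real t) = 0))"

end

theory Submission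
  imports Defs
begin

text \<open>
  On the real line \<open>p = \<phi>\<^bsub>\<ell>,\<eta>\<^esub>\<close> solves
  \<open>x p'' + (2\<ell> + 2) p' + (x - 2\<eta>) p = 0\<close> with \<open>p 0 = 1\<close>. Everything follows from the strict Laguerre
  inequality \<open>D = p'\<^sup>2 - p p'' > 0\<close> on all of \<open>\<real>\<close>, which says that \<open>p' / p\<close> decreases strictly wherever
  \<open>p\<close> does not vanish. Instead of using the reality of the zeros of \<open>\<phi>\<close> and its Hadamard product, the
  inequality is read off from the differential equation: combining the equation with its derivative
  gives the identity
  \<open>x D' + (2\<ell> + 3) D = p\<^sup>2 + p'\<^sup>2\<close>.
  At \<open>x = 0\<close> it shows \<open>D 0 > 0\<close>, because \<open>\<ell> > -3/2\<close> makes \<open>2\<ell> + 3\<close> positive; away from the origin it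
  says that \<open>\<bar>x\<bar> powr (2\<ell> + 3) * D x\<close> does not decrease as \<open>\<bar>x\<bar>\<close> grows, so that positivity spreads from
  a neighbourhood of \<open>0\<close> to the whole line (\<open>laguerre_inequality_coulomb_type\<close>).

  Two real functions whose Wronskian has no zero have interlaced zeros, by Rolle's theorem applied
  to their quotients (\<open>interlaced_if_wronskian_nonzero\<close>). The Wronskian of \<open>p\<close> and \<open>p'\<close> is \<open>-D\<close>, and
  that of \<open>x p\<close> and \<open>x p' + H p\<close> is \<open>-(x\<^sup>2 D + H p\<^sup>2)\<close>; both are negative everywhere.

  It remains to know that \<open>\<phi>\<close> is real on the real line and satisfies the equation. Both are checked on
  formal power series: the hypergeometric coefficient recurrence gives the Kummer equation, the factor
  \<open>exp (- \<i> x)\<close> turns it into the equation above, and the coefficient recurrence of the latter is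
  real, hence so are all Taylor coefficients of \<open>\<phi>\<close>.
\<close>

section \<open>Interlacing from a non-vanishing Wronskian\<close>

text \<open>
  If \<open>g\<close> had no zero between two zeros of \<open>f\<close>, then \<open>f / g\<close> would be differentiable there and vanish at
  both ends; but the numerator of its derivative is, up to sign, the Wronskian. The end points
  themselves cannot be zeros of \<open>g\<close>, since the Wronskian vanishes at a common zero.
\<close>

lemma zero_between_zeros_if_wronskian_nonzero:
  fixes f g f' g' :: "real \<Rightarrow> real"
  assumes f: "\<And>x. (f has_real_derivative f' x) (at x)"
    and g: "\<And>x. (g has_real_derivative g' x) (at x)"
    and W: "\<And>x. f x * g' x - f' x * g x \<noteq> 0"
    and ab: "a < b" "f a = 0" "f b = 0"
  shows "\<exists>t. a < t \<and> t < b \<and> g t = 0"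
proof (rule ccontr)
  assume no: "\<not> ?thesis"
  have "g a \<noteq> 0" "g b \<noteq> 0"
    using W[of a] W[of b] ab by auto
  with no have gnz: "g x \<noteq> 0" if "a \<le> x" "x \<le> b" for x
    using that by (metis order_le_less)
  have der: "((\<lambda>x. f x / g x) has_real_derivative (f' x * g x - f x * g' x) / (g x * g x)) (at x)"
    if "a \<le> x" "x \<le> b" for x
    by (rule DERIV_divide[OF f g gnz[OF that]])
  have "continuous_on {a..b} (\<lambda>x. f x / g x)"
    by (intro continuous_at_imp_continuous_on ballI DERIV_isCont[OF der]) auto
  from Rolle_deriv[OF \<open>a < b\<close> _ this der[unfolded has_field_derivative_def]]
  obtain z where z: "a < z" "z < b"
      "(*) ((f' z * g z - f z * g' z) / (g z * g z)) = (\<lambda>v. 0)"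
    using ab by auto
  from fun_cong[OF z(3), of 1] have "(f' z * g z - f z * g' z) / (g z * g z) = 0"
    by simp
  with gnz[of z] z W[of z] show False
    by auto
qed

text \<open>
  The previous lemma is symmetric in \<open>f\<close> and \<open>g\<close>: a second zero of \<open>g\<close> would force a further zero of
  \<open>f\<close> between the two.
\<close>

lemma unique_zero_between_consecutive_zeros:
  fixes f g f' g' :: "real \<Rightarrow> real"
  assumes f: "\<And>x. (f has_real_derivative f' x) (at x)"
    and g: "\<And>x. (g has_real_derivative g' x) (at x)"
    and W: "\<And>x. f x * g' x - f' x * g x \<noteq> 0"
    and ab: "a < b" "f a = 0" "f b = 0" "\<And>t. a < t \<Longrightarrow> t < b \<Longrightarrow> f t \<noteq> 0"
  shows "\<exists>!t. a < t \<and> t < b \<and> g t = 0"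
proof -
  have W': "g x * f' x - g' x * f x \<noteq> 0" for x
    using W[of x] by (simp add: algebra_simps)
  have no_two: False if st: "a < s" "s < t" "t < b" "g s = 0" "g t = 0" for s t
  proof -
    obtain r where "s < r" "r < t" "f r = 0"
      using zero_between_zeros_if_wronskian_nonzero[OF g f W' st(2,4,5)] by blast
    with ab(4)[of r] st show False by auto
  qed
  obtain t where t: "a < t" "t < b" "g t = 0"
    using zero_between_zeros_if_wronskian_nonzero[OF f g W ab(1-3)] by auto
  show ?thesis
  proof (rule ex1I[of _ t])
    show "s = t" if "a < s \<and> s < b \<and> g s = 0" for s
      using that t no_two[of s t] no_two[of t s] by (cases s t rule: linorder_cases) auto
  qed (use t in simp)
qed

lemma interlaced_if_wronskian_nonzero:
  fixes f g f' g' :: "real \<Rightarrow> real"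
  assumes F: "\<And>x. F (of_real x) = of_real (f x)"
    and G: "\<And>x. G (of_real x) = of_real (g x)"
    and f: "\<And>x. (f has_real_derivative f' x) (at x)"
    and g: "\<And>x. (g has_real_derivative g' x) (at x)"
    and W: "\<And>x. f x * g' x - f' x * g x \<noteq> 0"
  shows "real_zeros_interlaced F G"
proof -
  have W': "g x * f' x - g' x * f x \<noteq> 0" for x
    using W[of x] by (simp add: algebra_simps)
  show ?thesis
    unfolding real_zeros_interlaced_def consecutive_real_zeros_def F G of_real_eq_0_iff
  proof (intro conjI allI impI)
    show "\<nexists>t. f t = 0 \<and> g t = 0"
    proof
      assume "\<exists>t. f t = 0 \<and> g t = 0"
      then obtain t where "f t = 0" "g t = 0" by blast
      with W[of t] show False by simp
    qed
    show "\<exists>!t. a < t \<and> t < b \<and> g t = 0"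
      if "a < b \<and> f a = 0 \<and> f b = 0 \<and> (\<forall>t. a < t \<and> t < b \<longrightarrow> f t \<noteq> 0)" for a b
      by (rule unique_zero_between_consecutive_zeros[OF f g W]) (use that in auto)
    show "\<exists>!t. a < t \<and> t < b \<and> f t = 0"
      if "a < b \<and> g a = 0 \<and> g b = 0 \<and> (\<forall>t. a < t \<and> t < b \<longrightarrow> g t \<noteq> 0)" for a b
      by (rule unique_zero_between_consecutive_zeros[OF g f W']) (use that in auto)
  qed
qed

section \<open>Positivity from a first-order differential inequality\<close>

text \<open>
  For \<open>t > 0\<close> the hypothesis says that \<open>t powr c * D t\<close> is nondecreasing, since its derivative is
  \<open>t powr (c - 1) * (t * D' t + c * D t)\<close>. As this product need not be positive, or even continuous,
  at \<open>0\<close>, the comparison starts at a small \<open>e > 0\<close> where \<open>D\<close> is still positive by continuity.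
\<close>

lemma pos_if_euler_inequality_right:
  fixes D D' :: "real \<Rightarrow> real"
  assumes D: "\<And>x. (D has_real_derivative D' x) (at x)"
    and ineq: "\<And>x. x * D' x + c * D x \<ge> 0"
    and D0: "D 0 > 0" and x: "x > 0"
  shows "D x > 0"
proof -
  have "(D \<longlongrightarrow> D 0) (at_right 0)"
    using DERIV_isCont[OF D[of 0]] unfolding isCont_def by (rule filterlim_mono) (auto simp: at_le)
  then have "eventually (\<lambda>t. D t > 0) (at_right 0)"
    using D0 by (rule order_tendstoD(1))
  moreover have "eventually (\<lambda>t. t \<in> {0<..<x}) (at_right 0)"
    by (rule eventually_at_right_real[OF x])
  ultimately have "eventually (\<lambda>t. D t > 0 \<and> t \<in> {0<..<x}) (at_right 0)"
    by (rule eventually_conj)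
  then have "\<exists>t. D t > 0 \<and> t \<in> {0<..<x}"
    by (rule eventually_happens'[OF trivial_limit_at_right_real])
  then obtain e where e: "0 < e" "e < x" "D e > 0"
    by auto
  have "e powr c * D e \<le> x powr c * D x"
  proof (rule DERIV_nonneg_imp_nondecreasing[where f = "\<lambda>t. t powr c * D t"])
    fix t assume t: "e \<le> t" "t \<le> x"
    with e have "t > 0" by simp
    have "((\<lambda>t. t powr c * D t) has_real_derivative
            (c * t powr (c - 1)) * D t + D' t * t powr c) (at t)"
      by (rule DERIV_mult[OF has_real_derivative_powr[OF \<open>t > 0\<close>] D])
    also have "(c * t powr (c - 1)) * D t + D' t * t powr c = t powr (c - 1) * (t * D' t + c * D t)"
      using \<open>t > 0\<close> by (simp add: powr_diff field_simps)
    finally show "\<exists>y. ((\<lambda>t. t powr c * D t) has_real_derivative y) (at t) \<and> 0 \<le> y"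
      using ineq[of t] by (intro exI[of _ "t powr (c - 1) * (t * D' t + c * D t)"] conjI) auto
  qed (use e in simp)
  moreover have "e powr c * D e > 0"
    using e by simp
  ultimately have "x powr c * D x > 0"
    by linarith
  with x show ?thesis
    by (simp add: zero_less_mult_iff)
qed

text \<open>
  The Euler operator \<open>x * D' x\<close> is invariant under \<open>x \<mapsto> - x\<close>, so the negative half-line follows by
  reflection.
\<close>

lemma pos_if_euler_inequality:
  fixes D D' :: "real \<Rightarrow> real"
  assumes D: "\<And>x. (D has_real_derivative D' x) (at x)"
    and ineq: "\<And>x. x * D' x + c * D x \<ge> 0"
    and D0: "D 0 > 0"
  shows "D x > 0"
proof (cases "x < 0")
  case True
  have "((\<lambda>x. D (- x)) has_real_derivative - D' (- x)) (at x)" for x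
    using DERIV_chain2[OF D[of "- x"] DERIV_minus[OF DERIV_ident]] by simp
  moreover have "x * - D' (- x) + c * D (- x) \<ge> 0" for x
    using ineq[of "- x"] by simp
  ultimately have "D (- (- x)) > 0"
    by (rule pos_if_euler_inequality_right) (use D0 True in auto)
  then show ?thesis by simp
next
  case False
  then show ?thesis
    using pos_if_euler_inequality_right[OF D ineq D0] D0 by (cases "x = 0") simp_all
qed

text \<open>
  The equation and its derivative eliminate the explicit occurrences of \<open>x\<close> in \<open>x * D' x\<close>, where
  \<open>D\<close> is the left-hand side of the conclusion; what remains is a sum of squares minus a multiple of
  \<open>D\<close>. For \<open>b = 2 \<ell> + 2\<close> the bound \<open>b > -1\<close> is \<open>\<ell> > -3/2\<close>; it makes the sum of squares force
  \<open>D 0 > 0\<close>.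
\<close>

lemma laguerre_inequality_coulomb_type:
  fixes p p1 p2 p3 :: "real \<Rightarrow> real"
  assumes p: "\<And>x. (p has_real_derivative p1 x) (at x)"
    and p1: "\<And>x. (p1 has_real_derivative p2 x) (at x)"
    and p2: "\<And>x. (p2 has_real_derivative p3 x) (at x)"
    and ode: "\<And>x. x * p2 x + b * p1 x + (x - d) * p x = 0"
    and ode': "\<And>x. x * p3 x + (b + 1) * p2 x + (x - d) * p1 x + p x = 0"
    and b: "b > -1" and p0: "p 0 \<noteq> 0"
  shows "(p1 x)\<^sup>2 - p x * p2 x > 0"
proof -
  define D where "D x = p1 x * p1 x - p x * p2 x" for x
  define D' where "D' x = p1 x * p2 x - p x * p3 x" for x
  have der: "(D has_real_derivative D' x) (at x)" for x
    unfolding D_def D'_def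
    by (rule derivative_eq_intros p p1 p2 refl)+ (simp add: algebra_simps)
  have euler: "x * D' x + (b + 1) * D x = (p x)\<^sup>2 + (p1 x)\<^sup>2" for x
    using ode[of x] ode'[of x] unfolding D_def D'_def by algebra
  have "(b + 1) * D 0 > 0"
    using euler[of 0] p0 by (simp add: sum_power2_gt_zero_iff)
  with b have "D 0 > 0"
    by (simp add: zero_less_mult_iff)
  moreover have "x * D' x + (b + 1) * D x \<ge> 0" for x
    unfolding euler by simp
  ultimately have "D x > 0"
    using pos_if_euler_inequality[OF der] by blast
  then show ?thesis
    by (simp add: D_def power2_eq_square)
qed

section \<open>The Coulomb function as a real power series\<close>

text \<open>
  The Taylor series of \<open>z \<mapsto> \<^sub>1F\<^sub>1(a, b; c z)\<close>; the scaling by \<open>c\<close> is built in, which keeps the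
  composition with \<open>2 \<i> x\<close> out of the differential equations.
\<close>

definition kummer_fps :: "complex \<Rightarrow> complex \<Rightarrow> complex \<Rightarrow> complex fps" where
  "kummer_fps a b c = Abs_fps (\<lambda>k. pochhammer a k / pochhammer b k * (c ^ k / fact k))"

lemma eval_kummer_fps: "eval_fps (kummer_fps a b c) z = kummer_1F1 a b (c * z)"
  by (simp add: kummer_fps_def eval_fps_def kummer_1F1_def power_mult_distrib mult_ac)

lemma kummer_fps_Suc:
  assumes "pochhammer b (Suc k) \<noteq> 0"
  shows "of_nat (Suc k) * (b + of_nat k) * fps_nth (kummer_fps a b c) (Suc k) =
           c * (a + of_nat k) * fps_nth (kummer_fps a b c) k"
  using assms by (simp add: kummer_fps_def pochhammer_Suc divide_simps del: of_nat_Suc)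

text \<open>
  By the recurrence, consecutive terms have ratio \<open>c z (a + k) / ((b + k) (k + 1))\<close>, which tends to \<open>0\<close>.
  The estimate is kept in product form because the terms vanish from some point on when \<open>a\<close> is a
  nonpositive integer.
\<close>

lemma fps_conv_radius_kummer_fps:
  assumes b: "\<And>k. pochhammer b k \<noteq> 0"
  shows "fps_conv_radius (kummer_fps a b c) = \<infinity>"
  unfolding fps_conv_radius_def
proof (rule conv_radius_inftyI'')
  fix z :: complex
  let ?m = "fps_nth (kummer_fps a b c)"
  \<comment> \<open>from here on \<open>\<bar>a + k\<bar> \<le> 2 k\<close>, \<open>\<bar>b + k\<bar> \<ge> k / 2\<close> and \<open>\<bar>c z\<bar> \<le> k / 8\<close>, whence the ratio \<open>1/2\<close>\<close>
  define N where "N = Suc (nat \<lceil>norm a + 2 * norm b + 8 * norm (c * z)\<rceil>)"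
  show "summable (\<lambda>n. ?m n * z ^ n)"
  proof (rule summable_ratio_test[where c = "1/2" and N = N])
    fix k assume "k \<ge> N"
    then have k: "real k \<ge> 1" "norm a \<le> k" "2 * norm b \<le> k" "8 * norm (c * z) \<le> k"
    proof -
      have "real k \<ge> 1 + (norm a + 2 * norm b + 8 * norm (c * z))"
        using \<open>k \<ge> N\<close> unfolding N_def by linarith
      moreover have "norm a \<ge> 0" "norm b \<ge> 0" "norm (c * z) \<ge> 0" by simp_all
      ultimately show "real k \<ge> 1" "norm a \<le> k" "2 * norm b \<le> k" "8 * norm (c * z) \<le> k"
        by linarith+
    qed
    have a_le: "norm (a + of_nat k) \<le> 2 * real k"
      using norm_triangle_ineq[of a "of_nat k"] k by simp
    have b_ge: "norm (b + of_nat k) \<ge> real k / 2"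
      using norm_diff_ineq[of "of_nat k" b] k by (simp add: add.commute)
    have rec: "real (Suc k) * norm (b + of_nat k) * norm (?m (Suc k)) =
          norm c * norm (a + of_nat k) * norm (?m k)"
      using arg_cong[OF kummer_fps_Suc[OF b, of k a c], of norm]
      by (simp only: norm_mult norm_of_nat)
    have "real (Suc k) * norm (b + of_nat k) * norm (?m (Suc k) * z ^ Suc k) =
          (real (Suc k) * norm (b + of_nat k) * norm (?m (Suc k))) * norm (z ^ Suc k)"
      by (simp only: norm_mult mult.assoc)
    also have "\<dots> = norm (c * z) * norm (a + of_nat k) * norm (?m k * z ^ k)"
      unfolding rec by (simp add: norm_mult mult_ac)
    also have "\<dots> \<le> (real k / 8) * (2 * real k) * norm (?m k * z ^ k)"
      using k a_le by (intro mult_mono) auto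
    finally have 1: "real (Suc k) * norm (b + of_nat k) * norm (?m (Suc k) * z ^ Suc k)
        \<le> real k * (real k / 2) * (1/2 * norm (?m k * z ^ k))"
      by simp
    have "real k * (real k / 2) * norm (?m (Suc k) * z ^ Suc k)
        \<le> real (Suc k) * norm (b + of_nat k) * norm (?m (Suc k) * z ^ Suc k)"
      using b_ge by (intro mult_mono) auto
    with 1 have "real k * (real k / 2) * norm (?m (Suc k) * z ^ Suc k)
        \<le> real k * (real k / 2) * (1/2 * norm (?m k * z ^ k))"
      by linarith
    then show "norm (?m (Suc k) * z ^ Suc k) \<le> 1/2 * norm (?m k * z ^ k)"
      by (rule mult_left_le_imp_le) (use k in simp)
  qed simp
qed

text \<open>Kummer's equation for \<open>z \<mapsto> \<^sub>1F\<^sub>1(a, b; c z)\<close>; coefficientwise it is the recurrence above.\<close>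

lemma kummer_fps_ode:
  fixes a b c :: complex
  assumes b: "\<And>k. pochhammer b k \<noteq> 0"
  defines "G \<equiv> kummer_fps a b c"
  shows "fps_X * fps_deriv (fps_deriv G) + (fps_const b - fps_const c * fps_X) * fps_deriv G
           - fps_const (c * a) * G = 0"
proof (rule fps_ext)
  fix k
  show "fps_nth (fps_X * fps_deriv (fps_deriv G) + (fps_const b - fps_const c * fps_X) * fps_deriv G
           - fps_const (c * a) * G) k = fps_nth 0 k"
  proof (cases k)
    case 0
    then show ?thesis
      using kummer_fps_Suc[OF b, of 0 a c]
      by (simp add: G_def left_diff_distrib mult.assoc)
  next
    case (Suc n)
    have "of_nat (Suc k) * (b + of_nat k) * fps_nth G (Suc k) = c * (a + of_nat k) * fps_nth G k"
      unfolding G_def by (rule kummer_fps_Suc[OF b])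
    with Suc show ?thesis
      by (simp add: left_diff_distrib mult.assoc) (simp add: algebra_simps)
  qed
qed

definition coulomb_fps :: "real \<Rightarrow> real \<Rightarrow> complex fps" where
  "coulomb_fps l \<eta> =
     fps_exp (- \<i>) * kummer_fps (of_real (l + 1) - \<i> * of_real \<eta>) (of_real (2 * l + 2)) (2 * \<i>)"

definition coulomb_real_fps :: "real \<Rightarrow> real \<Rightarrow> real fps" where
  "coulomb_real_fps l \<eta> = Abs_fps (\<lambda>k. Re (fps_nth (coulomb_fps l \<eta>) k))"

context
  fixes l \<eta> :: real
  assumes l: "l > -3/2" "l \<noteq> -1"
begin

text \<open>
  The lower parameter \<open>2 \<ell> + 2\<close> exceeds \<open>-1\<close> and is not \<open>0\<close>, so it is no nonpositive integer.
\<close>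

lemma pochhammer_lower_nonzero: "pochhammer (complex_of_real (2 * l + 2)) k \<noteq> 0"
proof
  assume "pochhammer (complex_of_real (2 * l + 2)) k = 0"
  then obtain n where "complex_of_real (2 * l + 2) = - of_nat n"
    by (auto simp: pochhammer_eq_0_iff)
  then have "complex_of_real (2 * l + 2) = of_real (- real n)"
    by simp
  then have "2 * l + 2 = - real n"
    by (simp only: of_real_eq_iff)
  with l show False
    by (cases n) auto
qed

lemma fps_conv_radius_coulomb_fps: "fps_conv_radius (coulomb_fps l \<eta>) = \<infinity>"
  using fps_conv_radius_mult[of "fps_exp (- \<i>)"]
    fps_conv_radius_kummer_fps[OF pochhammer_lower_nonzero]
  unfolding coulomb_fps_def by (metis fps_conv_radius_exp min.idem ereal_infty_less_eq(1))

lemma eval_coulomb_fps: "eval_fps (coulomb_fps l \<eta>) = coulomb_phi l \<eta>"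
  unfolding coulomb_fps_def coulomb_phi_def
  by (rule ext, subst eval_fps_mult)
     (simp_all only: fps_conv_radius_kummer_fps[OF pochhammer_lower_nonzero] fps_conv_radius_exp
        eval_kummer_fps eval_fps_exp less_ereal.simps)

text \<open>
  Writing \<open>F = E G\<close> with \<open>E' = - \<i> E\<close>, the terms in \<open>G\<close> combine to \<open>E\<close> times Kummer's equation: the
  multiples of \<open>x G\<close> cancel because \<open>\<i>\<^sup>2 = -1\<close>, and \<open>\<i> (2 \<ell> + 2) + 2 \<eta> = 2 \<i> (\<ell> + 1 - \<i> \<eta>)\<close>
  identifies the remaining multiple of \<open>G\<close>.
\<close>

lemma coulomb_fps_ode:
  defines "F \<equiv> coulomb_fps l \<eta>"
  shows "fps_X * fps_deriv (fps_deriv F) + fps_const (of_real (2 * l + 2)) * fps_deriv F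
           + (fps_X - fps_const (of_real (2 * \<eta>))) * F = 0"
proof -
  define a where "a = complex_of_real (l + 1) - \<i> * of_real \<eta>"
  define b where "b = complex_of_real (2 * l + 2)"
  define G where "G = kummer_fps a b (2 * \<i>)"
  define E where "E = fps_exp (- \<i>)"
  \<comment> \<open>\<open>I\<close>, \<open>e\<close> and \<open>B\<close> are opaque names, as products of literal constants would be evaluated during ring normalisation\<close>
  define I where "I = fps_const \<i>"
  define e where "e = fps_const (complex_of_real \<eta>)"
  define B where "B = fps_const b"
  have II: "I * I = -1"
    by (simp add: I_def flip: fps_const_mult)
  have E': "fps_deriv E = - I * E"
    by (simp add: E_def I_def)
  have F: "F = E * G"
    by (simp add: F_def coulomb_fps_def E_def G_def a_def b_def)
  have F': "fps_deriv F = E * (fps_deriv G - I * G)"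
    by (simp add: F E' algebra_simps)
  have I': "fps_deriv I = 0"
    by (simp add: I_def)
  have F'': "fps_deriv (fps_deriv F) = E * (fps_deriv (fps_deriv G) - 2 * I * fps_deriv G + I * I * G)"
    unfolding F' by (simp add: E' I' algebra_simps)
  have ca: "fps_const (2 * \<i> * a) = I * B + 2 * e"
    by (simp add: a_def b_def I_def e_def B_def algebra_simps fps_eq_iff fps_numeral_nth)
  have c: "fps_const (2 * \<i>) = 2 * I"
    by (simp add: I_def fps_eq_iff fps_numeral_nth)
  have ode: "fps_X * fps_deriv (fps_deriv G) + (B - 2 * I * fps_X) * fps_deriv G
           - (I * B + 2 * e) * G = 0"
    using kummer_fps_ode[OF pochhammer_lower_nonzero, of a "2 * \<i>"]
    by (simp only: ca c flip: b_def B_def G_def)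
  have "fps_X * fps_deriv (fps_deriv F) + B * fps_deriv F + (fps_X - 2 * e) * F =
          E * (fps_X * fps_deriv (fps_deriv G) + (B - 2 * I * fps_X) * fps_deriv G
            - (I * B + 2 * e) * G) + (I * I + 1) * E * fps_X * G"
    unfolding F'' F' unfolding F by (simp add: E' I' algebra_simps)
  also have "\<dots> = 0"
    unfolding ode II by simp
  finally have "fps_X * fps_deriv (fps_deriv F) + B * fps_deriv F + (fps_X - 2 * e) * F = 0" .
  moreover have "2 * e = fps_const (of_real (2 * \<eta>))"
    by (simp add: e_def fps_eq_iff fps_numeral_nth)
  ultimately show ?thesis
    by (simp add: B_def b_def)
qed

lemma coulomb_fps_Suc:
  defines "F \<equiv> coulomb_fps l \<eta>"
  shows "of_real (real (Suc k) * (2 * l + 2 + real k)) * fps_nth F (Suc k) =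
           of_real (2 * \<eta>) * fps_nth F k - (if k = 0 then 0 else fps_nth F (k - 1))"
  using arg_cong[OF coulomb_fps_ode, of "\<lambda>f. fps_nth f k"]
  by (cases k) (simp_all add: F_def algebra_simps)

text \<open>
  The recurrence has real coefficients, and the factor of the new coefficient never vanishes, since
  \<open>2 \<ell> + 2\<close> is not a nonpositive integer.
\<close>

lemma coulomb_fps_real: "fps_nth (coulomb_fps l \<eta>) k \<in> \<real>"
proof (induction k rule: less_induct)
  case (less k)
  show ?case
  proof (cases k)
    case 0
    then show ?thesis
      by (simp add: coulomb_fps_def kummer_fps_def)
  next
    case (Suc n)
    have nz: "real (Suc n) * (2 * l + 2 + real n) \<noteq> 0"
      using l by (cases n) auto
    have "fps_nth (coulomb_fps l \<eta>) (n - 1) \<in> \<real>" "fps_nth (coulomb_fps l \<eta>) n \<in> \<real>"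
      using less Suc by auto
    then have "of_real (real (Suc n) * (2 * l + 2 + real n)) * fps_nth (coulomb_fps l \<eta>) (Suc n) \<in> \<real>"
      unfolding coulomb_fps_Suc by auto
    then show ?thesis
      using nz Suc by (metis Reals_of_real Reals_divide nonzero_mult_div_cancel_left of_real_eq_0_iff)
  qed
qed

lemma of_real_coulomb_real_fps:
  "of_real (fps_nth (coulomb_real_fps l \<eta>) k) = fps_nth (coulomb_fps l \<eta>) k"
  by (simp add: coulomb_real_fps_def coulomb_fps_real)

lemma fps_conv_radius_coulomb_real_fps: "fps_conv_radius (coulomb_real_fps l \<eta>) = \<infinity>"
proof -
  have "norm (fps_nth (coulomb_real_fps l \<eta>) k) = norm (fps_nth (coulomb_fps l \<eta>) k)" for k
    by (metis of_real_coulomb_real_fps norm_of_real real_norm_def)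
  then show ?thesis
    using fps_conv_radius_coulomb_fps unfolding fps_conv_radius_def conv_radius_def by simp
qed

lemma coulomb_real_fps_ode:
  defines "R \<equiv> coulomb_real_fps l \<eta>"
  shows "fps_X * fps_deriv (fps_deriv R) + fps_const (2 * l + 2) * fps_deriv R
           + (fps_X - fps_const (2 * \<eta>)) * R = 0"
proof (rule fps_ext)
  fix k
  have "real (Suc k) * (2 * l + 2 + real k) * fps_nth R (Suc k) =
          2 * \<eta> * fps_nth R k - (if k = 0 then 0 else fps_nth R (k - 1))"
    using arg_cong[OF coulomb_fps_Suc[of k], of Re]
    unfolding R_def by (cases k) (simp_all add: coulomb_real_fps_def)
  then show "fps_nth (fps_X * fps_deriv (fps_deriv R) + fps_const (2 * l + 2) * fps_deriv R
           + (fps_X - fps_const (2 * \<eta>)) * R) k = fps_nth 0 k"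
    by (cases k) (simp_all add: algebra_simps)
qed

lemma eval_coulomb_real_fps_ode:
  defines "R \<equiv> coulomb_real_fps l \<eta>"
  shows "x * eval_fps (fps_deriv (fps_deriv R)) x + (2 * l + 2) * eval_fps (fps_deriv R) x
           + (x - 2 * \<eta>) * eval_fps R x = 0"
proof -
  have entire_mult: "fps_conv_radius (f * g) = \<infinity>"
    if "fps_conv_radius f = \<infinity>" "fps_conv_radius g = \<infinity>" for f g :: "real fps"
    using fps_conv_radius_mult[of f g] that by simp
  have entire_add: "fps_conv_radius (f + g) = \<infinity>"
    if "fps_conv_radius f = \<infinity>" "fps_conv_radius g = \<infinity>" for f g :: "real fps"
    using fps_conv_radius_add[of f g] that by simp
  have entire_diff: "fps_conv_radius (f - g) = \<infinity>"
    if "fps_conv_radius f = \<infinity>" "fps_conv_radius g = \<infinity>" for f g :: "real fps"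
    using fps_conv_radius_diff[of f g] that by simp
  have entire_deriv: "fps_conv_radius (fps_deriv f) = \<infinity>"
    if "fps_conv_radius f = \<infinity>" for f :: "real fps"
    using fps_conv_radius_deriv[of f] that by auto
  have "fps_conv_radius R = \<infinity>"
    unfolding R_def by (rule fps_conv_radius_coulomb_real_fps)
  then have "x * eval_fps (fps_deriv (fps_deriv R)) x + (2 * l + 2) * eval_fps (fps_deriv R) x
               + (x - 2 * \<eta>) * eval_fps R x =
          eval_fps (fps_X * fps_deriv (fps_deriv R) + fps_const (2 * l + 2) * fps_deriv R
            + (fps_X - fps_const (2 * \<eta>)) * R) x"
    by (simp add: eval_fps_add eval_fps_mult eval_fps_diff
        entire_mult entire_add entire_diff entire_deriv)
  also have "\<dots> = 0"
    unfolding R_def coulomb_real_fps_ode by simp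
  finally show ?thesis .
qed

end

lemma eval_fps_of_real:
  assumes F: "\<And>k. fps_nth F k = complex_of_real (fps_nth R k)"
    and R: "fps_conv_radius R = \<infinity>"
  shows "eval_fps F (of_real x) = of_real (eval_fps R x)"
proof -
  have "summable (\<lambda>k. fps_nth R k * x ^ k)"
    by (rule summable_fps) (simp add: R)
  then show ?thesis
    unfolding eval_fps_def F by (simp add: suminf_of_real)
qed

section \<open>Interlacing of the zeros\<close>

theorem theorem5p3:
  fixes \<eta> l :: real
  assumes "l > -3/2" and "l \<noteq> -1" and "\<eta> \<noteq> 0"
  shows "(\<forall>H::real. H > 0 \<longrightarrow>
            real_zeros_interlaced
              (\<lambda>x. x * coulomb_phi l \<eta> x)
              (\<lambda>x. x * deriv (coulomb_phi l \<eta>) x + of_real H * coulomb_phi l \<eta> x)) \<and>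
         real_zeros_interlaced (coulomb_phi l \<eta>) (deriv (coulomb_phi l \<eta>))"
proof -
  note l = assms(1,2)
  define F where "F = coulomb_fps l \<eta>"
  define R where "R = coulomb_real_fps l \<eta>"
  define p where "p = eval_fps R"
  define p1 where "p1 = eval_fps (fps_deriv R)"
  define p2 where "p2 = eval_fps (fps_deriv (fps_deriv R))"
  define p3 where "p3 = eval_fps (fps_deriv (fps_deriv (fps_deriv R)))"
  have radR: "fps_conv_radius R = \<infinity>"
    unfolding R_def by (rule fps_conv_radius_coulomb_real_fps[OF l])
  have rad1: "fps_conv_radius (fps_deriv f) = \<infinity>"
    if "fps_conv_radius f = \<infinity>" for f :: "real fps"
    using fps_conv_radius_deriv[of f] that by auto
  note rad = radR rad1[OF radR] rad1[OF rad1[OF radR]] rad1[OF rad1[OF rad1[OF radR]]]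
  have radF: "fps_conv_radius F = \<infinity>"
    unfolding F_def by (rule fps_conv_radius_coulomb_fps[OF l])
  have FR: "fps_nth F k = of_real (fps_nth R k)" for k
    unfolding F_def R_def by (rule of_real_coulomb_real_fps[OF l, symmetric])
  have phi: "coulomb_phi l \<eta> (of_real x) = of_real (p x)" for x
    unfolding p_def eval_coulomb_fps[OF l, symmetric]
    using eval_fps_of_real[OF FR radR] by (simp add: F_def)
  have "deriv (coulomb_phi l \<eta>) z = eval_fps (fps_deriv F) z" for z
    unfolding F_def eval_coulomb_fps[OF l, symmetric]
    by (rule eval_fps_deriv[symmetric]) (use radF in \<open>simp add: F_def\<close>)
  moreover have "eval_fps (fps_deriv F) (of_real x) = of_real (p1 x)" for x
    unfolding p1_def by (rule eval_fps_of_real[OF _ rad(2)]) (simp add: FR)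
  ultimately have dphi: "deriv (coulomb_phi l \<eta>) (of_real x) = of_real (p1 x)" for x
    by simp
  have p: "(p has_real_derivative p1 x) (at x)" for x
    unfolding p_def p1_def by (rule has_field_derivative_eval_fps) (simp add: rad)
  have p1: "(p1 has_real_derivative p2 x) (at x)" for x
    unfolding p1_def p2_def by (rule has_field_derivative_eval_fps) (simp add: rad)
  have p2: "(p2 has_real_derivative p3 x) (at x)" for x
    unfolding p2_def p3_def by (rule has_field_derivative_eval_fps) (simp add: rad)
  have ode: "x * p2 x + (2 * l + 2) * p1 x + (x - 2 * \<eta>) * p x = 0" for x
    unfolding p_def p1_def p2_def R_def by (rule eval_coulomb_real_fps_ode[OF l])
  \<comment> \<open>the differentiated equation: the left-hand side of the equation is the zero function\<close>
  have ode': "x * p3 x + (2 * l + 2 + 1) * p2 x + (x - 2 * \<eta>) * p1 x + p x = 0" for x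
  proof -
    have "((\<lambda>x. x * p2 x + (2 * l + 2) * p1 x + (x - 2 * \<eta>) * p x) has_real_derivative
            x * p3 x + (2 * l + 2 + 1) * p2 x + (x - 2 * \<eta>) * p1 x + p x) (at x)"
      by (rule derivative_eq_intros p p1 p2 refl)+ (simp add: algebra_simps)
    then have "((\<lambda>x. 0) has_real_derivative
            x * p3 x + (2 * l + 2 + 1) * p2 x + (x - 2 * \<eta>) * p1 x + p x) (at x)"
      unfolding ode .
    then show ?thesis
      by (rule DERIV_unique) (rule DERIV_const)
  qed
  have p0: "p 0 = 1"
    by (simp add: p_def eval_fps_at_0 R_def coulomb_real_fps_def coulomb_fps_def kummer_fps_def)
  have D: "(p1 x)\<^sup>2 - p x * p2 x > 0" for x
    by (rule laguerre_inequality_coulomb_type[OF p p1 p2 ode ode']) (use l p0 in auto)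
  show ?thesis
  proof (intro conjI allI impI)
    fix H :: real assume H: "H > 0"
    show "real_zeros_interlaced
              (\<lambda>x. x * coulomb_phi l \<eta> x)
              (\<lambda>x. x * deriv (coulomb_phi l \<eta>) x + of_real H * coulomb_phi l \<eta> x)"
    proof (rule interlaced_if_wronskian_nonzero)
      fix x
      show "((\<lambda>x. x * p x) has_real_derivative p x + x * p1 x) (at x)"
        by (rule derivative_eq_intros p refl)+ simp
      show "((\<lambda>x. x * p1 x + H * p x) has_real_derivative p1 x + x * p2 x + H * p1 x) (at x)"
        by (rule derivative_eq_intros p p1 refl)+ simp
      have "(x * p x) * (p1 x + x * p2 x + H * p1 x) - (p x + x * p1 x) * (x * p1 x + H * p x) =
              - (x\<^sup>2 * ((p1 x)\<^sup>2 - p x * p2 x) + H * (p x)\<^sup>2)"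
        by algebra
      \<comment> \<open>at the origin the first summand vanishes, and \<open>H * (p 0)\<^sup>2 = H\<close> takes over\<close>
      moreover have "x\<^sup>2 * ((p1 x)\<^sup>2 - p x * p2 x) + H * (p x)\<^sup>2 > 0"
      proof (cases "x = 0")
        case False
        then show ?thesis
          using D[of x] H by (intro add_pos_nonneg) auto
      qed (use H p0 in simp)
      ultimately show "(x * p x) * (p1 x + x * p2 x + H * p1 x)
          - (p x + x * p1 x) * (x * p1 x + H * p x) \<noteq> 0"
        by linarith
    qed (simp_all add: phi dphi)
  next
    show "real_zeros_interlaced (coulomb_phi l \<eta>) (deriv (coulomb_phi l \<eta>))"
    proof (rule interlaced_if_wronskian_nonzero[OF phi dphi p p1])
      show "p x * p2 x - p1 x * p1 x \<noteq> 0" for x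
        using D[of x] by (simp add: power2_eq_square)
    qed
  qed
qed

end
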